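(* Let $X$ be a non-negative random variable with absolutely continuous distribution function $F$ and finite mean, and let $\alpha$ be a positive integer with $\alpha\neq1$. Then the cumulative residual Tsallis entropy of order $\alpha$ satisfies $$CRT_\alpha(X)=\frac{1}{\alpha-1}\mathcal{M}_{1,0,0}-\frac{\alpha}{\alpha-1}\mathcal{M}_{1,0,\alpha-1}.$$
   Context: $\bar F(x)=1-F(x)=P(X>x)$. The cumulative residual Tsallis entropy of order $\alpha>0$, $\alpha\ne1$, is $$CRT_\alpha(X)=\frac{1}{\alpha-1}\int_0^\infty\big(\bar F(x)-\bar F^\alpha(x)\big)\,dx.$$ For real $p,r,s$ for which the expectation exists, the probability weighted moment of $X$ is $\mathcal{M}_{p,r,s}=E\{X^pF^r(X)(1-F(X))^s\}$. *)

theory Defs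
  imports "HOL-Probability.Probability"
begin

text \<open>Absolute continuity of a real function in the classical epsilon-delta sense (the library's
  \<open>absolutely_continuous\<close> is about pairs of measures). The finite families of
  non-overlapping intervals are indexed by \<open>i < n\<close>.\<close>

definition abs_cont_on :: "real set \<Rightarrow> (real \<Rightarrow> real) \<Rightarrow> bool" where
  "abs_cont_on S f \<longleftrightarrow>
    (\<forall>\<epsilon>>0. \<exists>\<delta>>0. \<forall>(n::nat) a b.
      (\<forall>i<n. a i \<le> b i \<and> {a i..b i} \<subseteq> S) \<longrightarrow>
      disjoint_family_on (\<lambda>i. {a i<..<b i}) {..<n} \<longrightarrow>
      (\<Sum>i<n. b i - a i) < \<delta> \<longrightarrow>
      (\<Sum>i<n. \<bar>f (b i) - f (a i)\<bar>) < \<epsilon>)"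

definition dist_fun :: "'a measure \<Rightarrow> ('a \<Rightarrow> real) \<Rightarrow> real \<Rightarrow> real" where
  "dist_fun M X = cdf (distr M borel X)"

definition survival :: "'a measure \<Rightarrow> ('a \<Rightarrow> real) \<Rightarrow> real \<Rightarrow> real" where
  "survival M X x = 1 - dist_fun M X x"

definition CRT :: "real \<Rightarrow> 'a measure \<Rightarrow> ('a \<Rightarrow> real) \<Rightarrow> real" where
  "CRT \<alpha> M X =
    1 / (\<alpha> - 1) * (LINT x:{0..}|lborel. survival M X x - survival M X x powr \<alpha>)"

text \<open>Real powers of non-negative reals with the convention that the zeroth power is always 1,
  whereas \<open>0 powr 0 = 0\<close>. With plain \<open>powr\<close>, a factor with exponent 0 would
  silently annihilate the points where its base vanishes.\<close>

definition rpow :: "real \<Rightarrow> real \<Rightarrow> real" where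
  "rpow x a = (if a = 0 then 1 else x powr a)"

definition PWM :: "'a measure \<Rightarrow> ('a \<Rightarrow> real) \<Rightarrow> real \<Rightarrow> real \<Rightarrow> real \<Rightarrow> real" where
  "PWM M X p r s =
    (LINT \<omega>|M. rpow (X \<omega>) p * rpow (dist_fun M X (X \<omega>)) r * rpow (1 - dist_fun M X (X \<omega>)) s)"

end

theory Submission
  imports Defs
begin

text \<open>Write \<open>S = 1 - F\<close> and let \<open>\<mu>\<close> be the distribution of \<open>X\<close>. The layer-cake formula turns
  \<open>E (X S(X)^n)\<close> into the integral over \<open>x \<ge> 0\<close> of the integral of \<open>S^n\<close> against \<open>\<mu>\<close> over \<open>y > x\<close>.
  As \<open>F\<close> is continuous, the latter is \<open>S(x)^(n+1) / (n+1)\<close>. The cases \<open>n = 0\<close> and \<open>n = \<alpha> - 1\<close> give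
  the two terms of the entropy.\<close>

text \<open>A family of one interval turns absolute continuity into the epsilon-delta condition.
  Continuity of \<open>F\<close> is what rules out atoms below.\<close>

lemma abs_cont_on_UNIV_isCont:
  assumes "abs_cont_on UNIV f"
  shows "isCont f x"
proof (unfold continuous_at_eps_delta dist_real_def, intro allI impI)
  fix e :: real
  assume "e > 0"
  with assms obtain d where "d > 0" and d: "\<And>(n::nat) a b.
      (\<forall>i<n. a i \<le> b i \<and> {a i..b i} \<subseteq> UNIV) \<Longrightarrow>
      disjoint_family_on (\<lambda>i. {a i<..<b i}) {..<n} \<Longrightarrow>
      (\<Sum>i<n. b i - a i) < d \<Longrightarrow> (\<Sum>i<n. \<bar>f (b i) - f (a i)\<bar>) < e"
    unfolding abs_cont_on_def by meson
  have small: "\<bar>f v - f u\<bar> < e" if "u \<le> v" "v - u < d" for u v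
    using d[of 1 "\<lambda>_. u" "\<lambda>_. v"] that by (simp add: disjoint_family_on_def)
  show "\<exists>d>0. \<forall>y. \<bar>y - x\<bar> < d \<longrightarrow> \<bar>f y - f x\<bar> < e"
  proof (rule exI[of _ d], intro conjI allI impI)
    show "d > 0" by fact
    fix y assume "\<bar>y - x\<bar> < d"
    then show "\<bar>f y - f x\<bar> < e"
      using small[of x y] small[of y x] by (cases "x \<le> y") (auto simp: abs_minus_commute)
  qed
qed

context real_distribution
begin

lemma one_minus_cdf: "1 - cdf M x = measure M {x<..}"
  using prob_compl[of "{..x}"] by (simp add: cdf_def Compl_eq_Diff_UNIV[symmetric])

text \<open>Continuity at \<open>z\<close> means that \<open>z\<close> is no atom, so dropping the
  right endpoint from the half-open interval costs no mass.\<close>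

lemma measure_open_interval_eq_cdf_diff:
  assumes "isCont (cdf M) z" "x \<le> z"
  shows "measure M {x<..<z} = cdf M z - cdf M x"
proof (cases "x = z")
  case False
  with assms have "x < z" by simp
  then have "{x<..z} = {x<..<z} \<union> {z}" by auto
  then have "measure M {x<..z} = measure M {x<..<z} + measure M {z}"
    using finite_measure_Union[of "{x<..<z}" "{z}"] by simp
  with assms \<open>x < z\<close> show ?thesis
    by (simp add: isCont_cdf cdf_diff_eq)
qed simp

lemma borel_measurable_cdf [measurable]: "cdf M \<in> borel_measurable borel"
  by (intro borel_measurable_mono monoI cdf_nondecreasing)

text \<open>Since \<open>S(X)\<close> is uniformly distributed, these are its truncated moments. Swapping the two
  integrals in \<open>S y ^ Suc n = Suc n * (\<integral>z>y. S z ^ n)\<close> proves the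
  formula by induction without quantile functions.\<close>

lemma integral_tail_survival_power:
  assumes cont: "\<And>z. isCont (cdf M) z"
  shows "(LINT y|M. indicator {x<..} y * (1 - cdf M y) ^ n) = (1 - cdf M x) ^ Suc n / Suc n"
proof (induction n arbitrary: x)
  case 0
  then show ?case by (simp add: one_minus_cdf)
next
  case (Suc n)
  interpret P: pair_prob_space M M ..
  let ?S = "\<lambda>y. 1 - cdf M y"
  let ?h = "\<lambda>y z. indicator {x<..} y * (indicator {y<..} z * ?S z ^ n) :: real"
  have S: "0 \<le> ?S y" "?S y \<le> 1" for y
    by (auto simp: cdf_bounded_prob cdf_nonneg)
  then have S_power: "\<bar>?S y ^ k\<bar> \<le> 1" for y k
    by (metis abs_of_nonneg power_le_one zero_le_power)
  have integrable_tail: "integrable M (\<lambda>z. indicator {x<..} z * ?S z ^ k)" for k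
    by (rule integrable_const_bound[where B=1])
      (auto simp: S_power abs_mult split: split_indicator)
  let ?I = "\<lambda>k. LINT z|M. indicator {x<..} z * ?S z ^ k"
  have meas: "(\<lambda>(y, z). ?h y z) \<in> borel_measurable (M \<Otimes>\<^sub>M M)"
  proof -
    have "(\<lambda>(y, z). ?h y z) = (\<lambda>p. if x < fst p \<and> fst p < snd p then ?S (snd p) ^ n else 0)"
      by (auto simp: indicator_def)
    then show ?thesis by simp
  qed
  have "integrable (M \<Otimes>\<^sub>M M) (\<lambda>(y, z). ?h y z)"
    by (rule P.integrable_const_bound[where B=1])
      (use meas in \<open>auto simp: S_power abs_mult split: split_indicator\<close>)
  note Fubini = P.Fubini_integral[OF this]
  \<comment> \<open>For fixed \<open>z\<close> only the indicator of \<open>x < y < z\<close>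
    depends on \<open>y\<close>, and that interval has mass
    \<open>F z - F x = ?S x - ?S z\<close>.\<close>
  have inner: "(LINT y|M. ?h y z) = indicator {x<..} z * ?S z ^ n * (?S x - ?S z)" for z
  proof (cases "x < z")
    case True
    have "(LINT y|M. ?h y z) = (LINT y|M. ?S z ^ n * indicator {x<..<z} y)"
      by (intro Bochner_Integration.integral_cong) (auto simp: indicator_def)
    with True show ?thesis
      by (simp add: measure_open_interval_eq_cdf_diff cont)
  next
    case False
    then have "(\<lambda>y. ?h y z) = (\<lambda>_. 0)" by (auto simp: indicator_def)
    with False show ?thesis by simp
  qed
  have "?I (Suc n) / Suc n = (LINT y|M. indicator {x<..} y * (LINT z|M. indicator {y<..} z * ?S z ^ n))"
    by (simp add: Suc.IH)
  also have "\<dots> = (LINT y|M. LINT z|M. ?h y z)"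
    by simp
  also have "\<dots> = (LINT z|M. LINT y|M. ?h y z)"
    using Fubini by simp
  also have "\<dots> = (LINT z|M. ?S x * (indicator {x<..} z * ?S z ^ n) - indicator {x<..} z * ?S z ^ Suc n)"
    unfolding inner by (simp add: algebra_simps)
  also have "\<dots> = ?S x * ?I n - ?I (Suc n)"
    by (subst Bochner_Integration.integral_diff)
      (use integrable_tail[of n] integrable_tail[of "Suc n"] in auto)
  also have "\<dots> = ?S x ^ Suc (Suc n) / Suc n - ?I (Suc n)"
    by (simp add: Suc.IH)
  \<comment> \<open>The unknown \<open>?I (Suc n)\<close> stands on both sides of the chain;
    collecting it gives the factor \<open>1 / Suc n + 1 = Suc (Suc n) / Suc n\<close>.\<close>
  finally have "?I (Suc n) * Suc (Suc n) = ?S x ^ Suc (Suc n)"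
    by (simp add: field_simps)
  then show ?case by (simp add: eq_divide_eq)
qed

text \<open>For \<open>y\<close> at least 0, \<open>y\<close> is the length of the set of
  \<open>x\<close> with \<open>0 \<le> x < y\<close>; weighting by \<open>g y\<close> and applying
  Fubini gives the claim. The bounds on \<open>g\<close> make \<open>y\<close> a dominating
  function.\<close>

lemma layer_cake_weighted:
  assumes int: "integrable M (\<lambda>y. y)" and nonneg: "AE y in M. 0 \<le> y"
    and [measurable]: "g \<in> borel_measurable borel" and g: "\<And>y. 0 \<le> g y" "\<And>y. g y \<le> 1"
  shows "has_bochner_integral lborel
    (\<lambda>x. indicator {0..} x * (LINT y|M. indicator {x<..} y * g y)) (LINT y|M. y * g y)"
proof -
  interpret P: pair_sigma_finite M lborel ..
  let ?h = "\<lambda>y x. indicator {0..} x * (indicator {x<..} y * g y) :: real"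
  have meas: "(\<lambda>(y, x). ?h y x) \<in> borel_measurable (M \<Otimes>\<^sub>M lborel)"
  proof -
    have "(\<lambda>(y, x). ?h y x) = (\<lambda>p. if 0 \<le> snd p \<and> snd p < fst p then g (fst p) else 0)"
      by (auto simp: indicator_def)
    then show ?thesis by simp
  qed
  have h: "?h y = (\<lambda>x. g y * indicator {0..<y} x)" for y
    by (auto simp: indicator_def)
  have inner: "(LINT x|lborel. ?h y x) = y * g y" if "0 \<le> y" for y
    unfolding h using that by simp
  have "integrable (M \<Otimes>\<^sub>M lborel) (\<lambda>(y, x). ?h y x)"
  proof (rule P.Fubini_integrable[OF meas])
    have "integrable M (\<lambda>y. y * g y)"
      by (rule Bochner_Integration.integrable_bound[OF int])
        (auto simp: abs_mult g intro!: mult_left_le)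
    \<comment> \<open>The integrand \<open>?h\<close> is non-negative, so its norm integrates to the
      same value as \<open>?h\<close> itself.\<close>
    moreover have "AE y in M. y * g y = (LINT x|lborel. norm (case (y, x) of (y, x) \<Rightarrow> ?h y x))"
      using nonneg by eventually_elim (simp add: abs_mult g inner)
    ultimately show "integrable M (\<lambda>y. LINT x|lborel. norm (case (y, x) of (y, x) \<Rightarrow> ?h y x))"
      using meas by (subst integrable_cong_AE[symmetric]) auto
    show "AE y in M. integrable lborel (\<lambda>x. case (y, x) of (y, x) \<Rightarrow> ?h y x)"
      using nonneg unfolding h by eventually_elim simp
  qed
  note I = this
  have "(LINT x|lborel. LINT y|M. ?h y x) = (LINT y|M. LINT x|lborel. ?h y x)"
    using P.Fubini_integral[OF I] by simp
  also have "\<dots> = (LINT y|M. y * g y)"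
    using nonneg P.integrable_fst[OF I]
    by (intro integral_cong_AE) (auto simp: inner)
  finally show ?thesis
    using P.integrable_snd[OF I] by (simp add: has_bochner_integral_iff)
qed

text \<open>Combines the layer-cake formula for \<open>g = S ^ n\<close> with the truncated moments.
  Integrability is part of the claim so that two instances can be subtracted.\<close>

lemma has_bochner_integral_survival_power:
  assumes "\<And>z. isCont (cdf M) z" "integrable M (\<lambda>y. y)" "AE y in M. 0 \<le> y"
  shows "has_bochner_integral lborel (\<lambda>x. indicator {0..} x * (1 - cdf M x) ^ Suc n)
    (Suc n * (LINT y|M. y * (1 - cdf M y) ^ n))"
proof -
  have "has_bochner_integral lborel
      (\<lambda>x. indicator {0..} x * ((1 - cdf M x) ^ Suc n / Suc n)) (LINT y|M. y * (1 - cdf M y) ^ n)"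
    using layer_cake_weighted[OF assms(2,3), of "\<lambda>y. (1 - cdf M y) ^ n"]
    unfolding integral_tail_survival_power[OF assms(1)]
    by (auto simp: cdf_bounded_prob cdf_nonneg power_le_one)
  from has_bochner_integral_mult_right[OF this, of "real (Suc n)"] show ?thesis
    by simp
qed

end

theorem mainTheorem11:
  fixes M :: "'a measure" and X :: "'a \<Rightarrow> real" and \<alpha> :: nat
  assumes "prob_space M"
    and "X \<in> borel_measurable M"
    and "AE \<omega> in M. 0 \<le> X \<omega>"
    and "abs_cont_on UNIV (dist_fun M X)"
    and "integrable M X"
    and "\<alpha> > 0" and "\<alpha> \<noteq> 1"
  shows "CRT (real \<alpha>) M X =
    1 / (real \<alpha> - 1) * PWM M X 1 0 0 - real \<alpha> / (real \<alpha> - 1) * PWM M X 1 0 (real \<alpha> - 1)"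
proof -
  note [measurable] = assms(2)
  interpret prob_space M by fact
  let ?D = "distr M borel X"
  interpret D: real_distribution ?D by simp
  let ?S = "\<lambda>x. 1 - cdf ?D x"
  obtain n where \<alpha>: "\<alpha> = Suc n" "n > 0"
    using assms(6,7) by (cases \<alpha>) auto
  have S: "0 \<le> ?S x" for x
    by (simp add: D.cdf_bounded_prob)
  have cont: "isCont (cdf ?D) z" for z
    using abs_cont_on_UNIV_isCont[OF assms(4)] by (simp add: dist_fun_def)
  have int: "integrable ?D (\<lambda>y. y)" and nonneg: "AE y in ?D. 0 \<le> y"
    using assms(3,5) by (auto simp: integrable_distr_eq AE_distr_iff)
  note tail = D.has_bochner_integral_survival_power[OF cont int nonneg]
  have PWM_eq: "PWM M X 1 0 k = (LINT y|?D. y * ?S y ^ k)" for k :: nat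
  proof -
    \<comment> \<open>Both sides are 1 for \<open>k = 0\<close>, even where the survival function
      vanishes; this is where the convention in \<open>rpow\<close> matters.\<close>
    have "rpow (?S y) (real k) = ?S y ^ k" for y
      using S[of y] by (cases "k = 0") (auto simp: rpow_def powr_realpow')
    then have "PWM M X 1 0 k = (LINT \<omega>|M. rpow (X \<omega>) 1 * ?S (X \<omega>) ^ k)"
      by (simp add: PWM_def dist_fun_def rpow_def)
    also have "\<dots> = (LINT \<omega>|M. X \<omega> * ?S (X \<omega>) ^ k)"
      \<comment> \<open>\<open>powr\<close> with exponent 1 is the identity on non-negative reals,
        hence almost surely at \<open>X\<close>.\<close>
      using assms(3) by (intro integral_cong_AE) (auto simp: rpow_def)
    also have "\<dots> = (LINT y|?D. y * ?S y ^ k)"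
      by (simp add: integral_distr)
    finally show ?thesis .
  qed
  have "(LINT x:{0..}|lborel. survival M X x - survival M X x powr real \<alpha>) =
      (LINT x|lborel. indicator {0..} x * ?S x ^ Suc 0 - indicator {0..} x * ?S x ^ Suc n)"
    unfolding set_lebesgue_integral_def survival_def dist_fun_def \<alpha>
    \<comment> \<open>The exponent \<open>Suc n\<close> is nonzero, so \<open>powr\<close> and the
      natural power agree also where the survival function is 0.\<close>
    by (intro Bochner_Integration.integral_cong refl, subst powr_realpow')
      (auto simp: D.cdf_bounded_prob right_diff_distrib)
  also have "\<dots> = PWM M X 1 0 0 - real \<alpha> * PWM M X 1 0 (real \<alpha> - 1)"
    \<comment> \<open>The factors \<open>Suc 0\<close> and \<open>Suc n\<close> from
      \<open>tail\<close> become the coefficients 1 and \<alpha>.\<close>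
    using has_bochner_integral_diff[OF tail[of 0] tail[of n]] PWM_eq[of 0] PWM_eq[of n]
    by (simp add: has_bochner_integral_iff \<alpha> del: of_nat_Suc) (simp add: \<alpha>)
  finally show ?thesis
    unfolding CRT_def by (simp add: right_diff_distrib)
qed

end
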